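(* Let $K$ be a Cantor set in $\mathbb{R}^d$. Then there exists a dense $G_\delta$ set $G\subset\mathbb{R}^d$ such that for every $g\in C^1_{\mathsf{inv}}(\mathbb{R}^d)$, $G$ does not contain $g(K)$.
   Context: A Cantor set in $\mathbb{R}^d$ is a (non-empty) compact, totally disconnected, perfect subset of $\mathbb{R}^d$. $C^1_{\mathsf{inv}}(\mathbb{R}^d)$ is the set of continuously differentiable maps $g:\mathbb{R}^d\to\mathbb{R}^d$ whose Jacobian matrix $J_g(x)$ is invertible at every $x\in\mathbb{R}^d$. *)

theory Defs
  imports "HOL-Analysis.Analysis"
begin

definition totally_disconnected :: "'a::topological_space set \<Rightarrow> bool" where
  "totally_disconnected S \<longleftrightarrow> (\<forall>x\<in>S. connected_component_set S x = {x})"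

definition perfect :: "'a::topological_space set \<Rightarrow> bool" where
  "perfect S \<longleftrightarrow> {x. x islimpt S} = S"

definition cantor_set :: "'a::topological_space set \<Rightarrow> bool" where
  "cantor_set K \<longleftrightarrow> K \<noteq> {} \<and> compact K \<and> totally_disconnected K \<and> perfect K"

text \<open>
  Continuous differentiability is expressed as differentiability together with continuity of
  the Jacobian matrix, i.e. of all partial derivatives. The separate differentiability
  condition is needed, since \<^const>\<open>jacobian\<close> is unspecified where the function
  is not differentiable.
\<close>

definition C1_inv :: "(real ^ 'n::finite \<Rightarrow> real ^ 'n) set" where
  "C1_inv = {g. (\<forall>x. g differentiable (at x)) \<and>
                continuous_on UNIV (\<lambda>x. jacobian g (at x)) \<and>
                (\<forall>x. invertible (jacobian g (at x)))}"

end

theory Submission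
  imports Defs
begin

text \<open>
  Only compactness and perfectness of \<open>K\<close> matter. By compactness, for each scale \<open>r\<close>
  there is a scale \<open>s\<close> such that, in every ball of radius \<open>r\<close> centred in \<open>K\<close>, one can avoid any
  given set of diameter less than \<open>s\<close> by passing to a ball of radius \<open>s\<close> centred in \<open>K\<close>.
  Iterating, one obtains scales \<open>\<rho> n\<close> such that no ball of radius \<open>\<rho> m\<close> centred in \<open>K\<close> has its
  trace on \<open>K\<close> covered by sets \<open>E n\<close>, \<open>n \<ge> m\<close>, of diameter less than \<open>\<rho> (Suc n)\<close>. Let \<open>G\<close>
  be the limsup of balls around a sequence with dense tails, with radii \<open>\<epsilon> n\<close> tending to \<open>0\<close> faster than
  \<open>\<rho> (Suc n)\<close>. A map in \<^term>\<open>C1_inv\<close> locally has a Lipschitz inverse, so the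
  preimages of these balls near a point of \<open>K\<close> eventually have diameter less than \<open>\<rho> (Suc n)\<close>
  and cannot cover \<open>K\<close> there.
\<close>

text \<open>Finitely many balls of radius \<open>r / 4\<close> with centres \<open>c\<close> in
  \<open>K\<close> cover \<open>K\<close>, and perfectness gives each \<open>c\<close> a companion
  \<open>p c\<close> in \<open>K\<close>. If \<open>E\<close> has small diameter compared with all
  the gaps \<open>dist (p c) c\<close>, it misses a small ball around \<open>c\<close> or one around
  \<open>p c\<close>. As there are finitely many gaps, one scale serves every
  \<open>x\<close>.\<close>

lemma compact_perfect_avoid_step:
  fixes K :: "'a::metric_space set"
  assumes "compact K" and perf: "\<And>x. x \<in> K \<Longrightarrow> x islimpt K" and "0 < r"
  shows "\<exists>s>0. s \<le> r / 2 \<and> (\<forall>x\<in>K. \<forall>E. (\<forall>a\<in>E. \<forall>b\<in>E. dist a b < s) \<longrightarrow>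
    (\<exists>y\<in>K. cball y s \<subseteq> cball x r \<and> cball y s \<inter> E = {}))"
proof -
  have "\<exists>y\<in>K. y \<noteq> c \<and> dist y c < r / 4" if "c \<in> K" for c
    using perf[OF that] \<open>0 < r\<close> unfolding islimpt_approachable
    by (meson divide_pos_pos zero_less_numeral)
  then obtain p where p: "\<And>c. c \<in> K \<Longrightarrow> p c \<in> K \<and> p c \<noteq> c \<and> dist (p c) c < r / 4"
    by metis
  obtain C where C: "C \<subseteq> K" "finite C" "K \<subseteq> (\<Union>c\<in>C. ball c (r / 4))"
    using compactE_image[OF \<open>compact K\<close>, of K "\<lambda>c. ball c (r / 4)"] \<open>0 < r\<close> by force
  \<comment> \<open>Inserting \<open>r\<close> bounds \<open>\<eta>\<close> by \<open>r\<close> and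
    keeps the set nonempty even if \<open>C\<close> is empty.\<close>
  define \<eta> where "\<eta> = Min (insert r ((\<lambda>c. dist (p c) c) ` C))"
  have "0 < \<eta>"
    using C p \<open>0 < r\<close> by (auto simp: \<eta>_def)
  have "\<eta> \<le> r" and \<eta>: "\<And>c. c \<in> C \<Longrightarrow> \<eta> \<le> dist (p c) c"
    using C by (auto simp: \<eta>_def)
  show ?thesis
  proof (intro exI[of _ "\<eta> / 4"] conjI ballI allI impI)
    show "0 < \<eta> / 4" "\<eta> / 4 \<le> r / 2"
      using \<open>0 < \<eta>\<close> \<open>\<eta> \<le> r\<close> by auto
  next
    fix x and E :: "'a set"
    assume "x \<in> K" and E: "\<forall>a\<in>E. \<forall>b\<in>E. dist a b < \<eta> / 4"
    then obtain c where c: "c \<in> C" "dist c x < r / 4"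
      using C by auto
    then have cK: "c \<in> K" "p c \<in> K" "dist (p c) c < r / 4"
      using C p by auto
    have sub: "cball y (\<eta> / 4) \<subseteq> cball x r" if "dist x y \<le> r / 2" for y
    proof
      fix z assume "z \<in> cball y (\<eta> / 4)"
      then show "z \<in> cball x r"
        using that \<open>\<eta> \<le> r\<close> \<open>0 < r\<close> dist_triangle[of x z y] by simp
    qed
    have "cball c (\<eta> / 4) \<subseteq> cball x r" "cball (p c) (\<eta> / 4) \<subseteq> cball x r"
      using c cK \<open>0 < r\<close> dist_triangle[of x "p c" c] by (auto intro!: sub simp: dist_commute)
    moreover have "cball c (\<eta> / 4) \<inter> E = {} \<or> cball (p c) (\<eta> / 4) \<inter> E = {}"
    \<comment> \<open>Points of \<open>E\<close> in both balls would give
      \<open>dist (p c) c < 3 * \<eta> / 4\<close>.\<close>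
    proof (rule ccontr)
      assume "\<not> ?thesis"
      then obtain a b where "a \<in> E" "b \<in> E" "dist c a \<le> \<eta> / 4" "dist (p c) b \<le> \<eta> / 4"
        by auto
      then show False
        using E[rule_format, of b a] \<eta>[OF \<open>c \<in> C\<close>] \<open>0 < \<eta>\<close> dist_triangle[of "p c" c b] dist_triangle[of b c a]
        by (simp add: dist_commute)
    qed
    ultimately show "\<exists>y\<in>K. cball y (\<eta> / 4) \<subseteq> cball x r \<and> cball y (\<eta> / 4) \<inter> E = {}"
      using cK by blast
  qed
qed

text \<open>The scales are chosen before \<open>m\<close>, \<open>x\<close> and \<open>E\<close> are
  known. Given these, nested balls are built, the one of radius \<open>\<rho> (Suc n)\<close>
  avoiding \<open>E n\<close>; a point of \<open>K\<close> common to all of them exists by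
  compactness.\<close>

lemma compact_perfect_avoid_sequence:
  fixes K :: "'a::heine_borel set"
  assumes "compact K" and perf: "\<And>x. x \<in> K \<Longrightarrow> x islimpt K"
  obtains \<rho> :: "nat \<Rightarrow> real" where "\<And>n. 0 < \<rho> n" "\<rho> \<longlonglongrightarrow> 0"
    "\<And>m x E. x \<in> K \<Longrightarrow> (\<And>n a b. m \<le> n \<Longrightarrow> a \<in> E n \<Longrightarrow> b \<in> E n \<Longrightarrow> dist a b < \<rho> (Suc n)) \<Longrightarrow>
       \<exists>z\<in>K \<inter> cball x (\<rho> m). \<forall>n\<ge>m. z \<notin> E n"
proof -
  let ?Q = "\<lambda>r s. s \<le> r / 2 \<and> (\<forall>x\<in>K. \<forall>E. (\<forall>a\<in>E. \<forall>b\<in>E. dist a b < s) \<longrightarrow>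
       (\<exists>y\<in>K. cball y s \<subseteq> cball x r \<and> cball y s \<inter> E = {}))"
  have "\<exists>\<rho>. \<forall>n::nat. 0 < \<rho> n \<and> ?Q (\<rho> n) (\<rho> (Suc n))"
  proof (rule dependent_nat_choice)
    show "\<exists>r::real. 0 < r"
      by (rule exI[of _ 1]) simp
    show "\<exists>s>0. ?Q r s" if "0 < r" for r
      by (rule compact_perfect_avoid_step[OF assms that])
  qed
  then obtain \<rho> :: "nat \<Rightarrow> real" where pos: "\<And>n. 0 < \<rho> n"
    and half: "\<And>n. \<rho> (Suc n) \<le> \<rho> n / 2"
    and step: "\<And>n. \<forall>x\<in>K. \<forall>E. (\<forall>a\<in>E. \<forall>b\<in>E. dist a b < \<rho> (Suc n)) \<longrightarrow>
       (\<exists>y\<in>K. cball y (\<rho> (Suc n)) \<subseteq> cball x (\<rho> n) \<and> cball y (\<rho> (Suc n)) \<inter> E = {})"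
    by (elim exE) blast
  show thesis
  proof
    show "0 < \<rho> n" for n by (rule pos)
    have bound: "\<rho> n \<le> \<rho> 0 * (1 / 2) ^ n" for n
    proof (induction n)
      case (Suc n)
      then show ?case using half[of n] by simp
    qed simp
    have "(\<lambda>n. \<rho> 0 * (1 / 2) ^ n) \<longlonglongrightarrow> 0"
      by (intro tendsto_mult_right_zero LIMSEQ_power_zero) simp
    then show "\<rho> \<longlonglongrightarrow> 0"
      by (rule tendsto_sandwich[rotated 3, OF _ ]) (auto simp: bound less_imp_le[OF pos])
  next
    fix m x and E :: "nat \<Rightarrow> 'a set"
    assume "x \<in> K" and E: "\<And>n a b. m \<le> n \<Longrightarrow> a \<in> E n \<Longrightarrow> b \<in> E n \<Longrightarrow> dist a b < \<rho> (Suc n)"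
    let ?S = "\<lambda>k y. cball y (\<rho> (m + k))"
    \<comment> \<open>The clause for \<open>k = 0\<close> makes the dependent choice start at
      \<open>x\<close>.\<close>
    have "\<exists>f. \<forall>k. (f k \<in> K \<and> (k = 0 \<longrightarrow> f k = x)) \<and>
        (?S (Suc k) (f (Suc k)) \<subseteq> ?S k (f k) \<and> ?S (Suc k) (f (Suc k)) \<inter> E (m + k) = {})"
    proof (intro dependent_nat_choice)
      fix y and k :: nat assume "y \<in> K \<and> (k = 0 \<longrightarrow> y = x)"
      then show "\<exists>z. (z \<in> K \<and> (Suc k = 0 \<longrightarrow> z = x)) \<and>
          (?S (Suc k) z \<subseteq> ?S k y \<and> ?S (Suc k) z \<inter> E (m + k) = {})"
        using step[of "m + k", rule_format, of y "E (m + k)"] E[of "m + k"] by force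
    qed (use \<open>x \<in> K\<close> in auto)
    then obtain f where "\<forall>k. (f k \<in> K \<and> (k = 0 \<longrightarrow> f k = x)) \<and>
        (?S (Suc k) (f (Suc k)) \<subseteq> ?S k (f k) \<and> ?S (Suc k) (f (Suc k)) \<inter> E (m + k) = {})" ..
    then have fK: "f k \<in> K" and f0: "f 0 = x"
      and dec: "?S (Suc k) (f (Suc k)) \<subseteq> ?S k (f k)"
      and avoid: "?S (Suc k) (f (Suc k)) \<inter> E (m + k) = {}" for k
      by simp_all
    let ?F = "\<lambda>k. K \<inter> ?S k (f k)"
    have "\<Inter>(range ?F) \<noteq> {}"
    proof (rule compact_nest)
      show "compact (?F k)" for k
        using \<open>compact K\<close> by (intro compact_Int_closed) auto
      show "?F k \<noteq> {}" for k
        using fK[of k] pos[of "m + k"] by force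
      show "?F l \<subseteq> ?F k" if "k \<le> l" for k l
        using lift_Suc_antimono_le[of "\<lambda>k. ?S k (f k)", OF dec that] by blast
    qed
    then obtain z where z: "\<And>k. z \<in> ?F k"
      by blast
    have "z \<notin> E n" if "m \<le> n" for n
      using z[of "Suc (n - m)"] avoid[of "n - m"] that by auto
    then show "\<exists>z\<in>K \<inter> cball x (\<rho> m). \<forall>n\<ge>m. z \<notin> E n"
      using z[of 0] f0 by (intro bexI[of _ z]) auto
  qed
qed

text \<open>Near \<open>x0\<close>, \<open>g\<close> is the linear map \<open>?J x0\<close>, which
  stretches by at least some \<open>B > 0\<close>, plus a remainder that has Lipschitz constant
  \<open>B / 2\<close> by the mean value inequality. Thus \<open>c = B / 2\<close> works.\<close>

lemma C1_inv_locally_expanding: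
  fixes g :: "real ^ 'n::finite \<Rightarrow> real ^ 'n"
  assumes "g \<in> C1_inv"
  obtains c d where "0 < c" "0 < d"
    "\<And>x y. x \<in> ball x0 d \<Longrightarrow> y \<in> ball x0 d \<Longrightarrow> c * dist x y \<le> dist (g x) (g y)"
proof -
  let ?J = "\<lambda>x. jacobian g (at x)"
  have der: "\<And>x. (g has_derivative (*v) (?J x)) (at x)"
    and cont: "continuous_on UNIV ?J" and inv: "invertible (?J x0)"
    using assms by (auto simp: C1_inv_def jacobian_works)
  obtain B where B: "0 < B" "\<And>v. B * norm v \<le> norm (?J x0 *v v)"
    using linear_inj_bounded_below_pos[OF matrix_vector_mul_linear inj_matrix_vector_mult[OF inv]]
    by blast
  \<comment> \<open>The limit is \<open>0\<close>, and the sum of absolute entries dominates the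
    operator norm.\<close>
  have "((\<lambda>x. \<Sum>i\<in>UNIV. \<Sum>j\<in>UNIV. \<bar>(?J x - ?J x0) $ i $ j\<bar>) \<longlongrightarrow>
      (\<Sum>i\<in>UNIV. \<Sum>j\<in>UNIV. \<bar>(?J x0 - ?J x0) $ i $ j\<bar>)) (at x0)"
    using cont by (intro tendsto_intros) (auto simp: continuous_on_def)
  then have "\<forall>\<^sub>F x in at x0. (\<Sum>i\<in>UNIV. \<Sum>j\<in>UNIV. \<bar>(?J x - ?J x0) $ i $ j\<bar>) < B / 2"
    by (rule order_tendstoD) (use B in simp)
  then obtain d where d: "0 < d" "\<And>x. x \<noteq> x0 \<Longrightarrow> dist x x0 < d \<Longrightarrow>
      (\<Sum>i\<in>UNIV. \<Sum>j\<in>UNIV. \<bar>(?J x - ?J x0) $ i $ j\<bar>) < B / 2"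
    unfolding eventually_at by blast
  have small: "onorm ((*v) (?J x - ?J x0)) \<le> B / 2" if "x \<in> ball x0 d" for x
  proof (cases "x = x0")
    case True
    then show ?thesis using B onorm_le_matrix_component_sum[of "?J x - ?J x0"] by simp
  next
    case False
    then show ?thesis
      using d(2)[of x] that onorm_le_matrix_component_sum[of "?J x - ?J x0"]
      by (simp add: dist_commute)
  qed
  show thesis
  proof
    show "0 < B / 2" "0 < d" using B d by auto
    fix x y assume xy: "x \<in> ball x0 d" "y \<in> ball x0 d"
    let ?h = "\<lambda>x. g x - ?J x0 *v x"
    have "norm (?h x - ?h y) \<le> B / 2 * norm (x - y)"
    proof (rule differentiable_bound[OF convex_ball _ small xy])
      fix z assume "z \<in> ball x0 d"
      have "(?h has_derivative (\<lambda>v. ?J z *v v - ?J x0 *v v)) (at z)"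
        by (intro has_derivative_diff der linear_imp_has_derivative matrix_vector_mul_linear)
      then show "(?h has_derivative (*v) (?J z - ?J x0)) (at z within ball x0 d)"
        unfolding matrix_vector_mult_diff_rdistrib[symmetric] by (rule has_derivative_at_withinI)
    qed
    moreover have "?J x0 *v (x - y) = (g x - g y) - (?h x - ?h y)"
      by (simp add: matrix_vector_mult_diff_distrib)
    then have "norm (?J x0 *v (x - y)) \<le> norm (g x - g y) + norm (?h x - ?h y)"
      by (metis norm_triangle_ineq4)
    ultimately show "B / 2 * dist x y \<le> dist (g x) (g y)"
      using B(2)[of "x - y"] by (simp add: dist_norm)
  qed
qed

text \<open>Decoding indices as pairs repeats each point of a countable dense set infinitely often;
  the index \<open>prod_encode (i, m)\<close> is at least \<open>m\<close>.\<close>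

lemma ex_sequence_all_tails_dense:
  obtains q :: "nat \<Rightarrow> 'a::second_countable_topology"
  where "\<And>U m. open U \<Longrightarrow> U \<noteq> {} \<Longrightarrow> \<exists>n\<ge>m. q n \<in> U"
proof -
  obtain D :: "'a set" where D: "countable D" "\<And>X. open X \<Longrightarrow> X \<noteq> {} \<Longrightarrow> \<exists>d\<in>D. d \<in> X"
    using countable_dense_setE by blast
  show thesis
  proof
    fix U :: "'a set" and m :: nat
    assume "open U" "U \<noteq> {}"
    then obtain d where "d \<in> D" "d \<in> U"
      using D by blast
    then obtain i where "from_nat_into D i = d"
      using D(1) by (metis from_nat_into_surj)
    then show "\<exists>n\<ge>m. from_nat_into D (fst (prod_decode n)) \<in> U"
      using \<open>d \<in> U\<close> by (intro exI[of _ "prod_encode (i, m)"]) (simp add: le_prod_encode_2)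
  qed
qed

theorem theorem8p1:
  fixes K :: "(real ^ 'n::finite) set"
  assumes "cantor_set K"
  shows "\<exists>G :: (real ^ 'n) set. gdelta G \<and> closure G = UNIV \<and>
           (\<forall>g \<in> C1_inv. \<not> g ` K \<subseteq> G)"
proof -
  have K: "compact K" "\<And>x. x \<in> K \<Longrightarrow> x islimpt K" and "K \<noteq> {}"
    using assms by (auto simp: cantor_set_def perfect_def)
  obtain \<rho> where pos: "\<And>n. 0 < \<rho> n" and lim: "\<rho> \<longlonglongrightarrow> 0"
    and avoid: "\<And>m x E. x \<in> K \<Longrightarrow>
      (\<And>n a b. m \<le> n \<Longrightarrow> a \<in> E n \<Longrightarrow> b \<in> E n \<Longrightarrow> dist a b < \<rho> (Suc n)) \<Longrightarrow>
      \<exists>z\<in>K \<inter> cball x (\<rho> m). \<forall>n\<ge>m. z \<notin> E n"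
    using compact_perfect_avoid_sequence[OF K] by blast
  obtain q :: "nat \<Rightarrow> real ^ 'n" where q: "\<And>U m. open U \<Longrightarrow> U \<noteq> {} \<Longrightarrow> \<exists>n\<ge>m. q n \<in> U"
    using ex_sequence_all_tails_dense by blast
  \<comment> \<open>The factor 2 turns radii into diameters. The factor \<open>Suc n\<close>
    eventually exceeds \<open>1 / c\<close> for any expansion constant \<open>c\<close>, so one
    \<open>G\<close> serves all \<open>g\<close>.\<close>
  define \<epsilon> where "\<epsilon> n = \<rho> (Suc n) / (2 * real (Suc n))" for n
  define W where "W m = (\<Union>n\<in>{m..}. ball (q n) (\<epsilon> n))" for m
  have \<epsilon>: "0 < \<epsilon> n" for n
    by (simp add: \<epsilon>_def pos)
  have "open (W m)" for m
    by (auto simp: W_def)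
  have "closure (W m) = UNIV" for m
  proof (rule ccontr)
    assume "closure (W m) \<noteq> UNIV"
    then obtain n where "m \<le> n" "q n \<in> - closure (W m)"
      using q[of "- closure (W m)" m] by auto
    moreover have "q n \<in> W m"
      using \<open>m \<le> n\<close> \<epsilon>[of n] by (auto simp: W_def intro!: bexI[of _ n])
    ultimately show False
      using closure_subset by blast
  qed
  have "UNIV \<subseteq> closure (\<Inter>(range W))"
    by (rule Baire) (auto simp: \<open>open (W _)\<close> \<open>closure (W _) = UNIV\<close>)
  moreover have "gdelta (\<Inter>(range W))"
    by (rule gdelta.intros) (rule \<open>open (W _)\<close>)
  moreover have "\<not> g ` K \<subseteq> \<Inter>(range W)" if g: "g \<in> C1_inv" for g
  proof
    assume sub: "g ` K \<subseteq> \<Inter>(range W)"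
    obtain x0 where "x0 \<in> K"
      using \<open>K \<noteq> {}\<close> by blast
    obtain c d where cd: "0 < c" "0 < d"
      and expand: "\<And>x y. x \<in> ball x0 d \<Longrightarrow> y \<in> ball x0 d \<Longrightarrow> c * dist x y \<le> dist (g x) (g y)"
      using C1_inv_locally_expanding[OF g] by blast
    \<comment> \<open>The first condition keeps the point found by \<open>avoid\<close> inside the
      ball where \<open>expand\<close> applies; the second makes \<open>E n\<close> small enough for
      all \<open>n \<ge> m\<close>.\<close>
    have "\<forall>\<^sub>F m in sequentially. \<rho> m < d \<and> 1 / c < real m"
      using order_tendstoD(2)[OF lim \<open>0 < d\<close>] filterlim_real_sequentially
      by (intro eventually_conj) (auto simp: filterlim_at_top_dense)
    then obtain m where m: "\<rho> m < d" "1 / c < real m"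
      using eventually_happens'[OF sequentially_bot] by blast
    define E where "E n = {x \<in> ball x0 d. g x \<in> ball (q n) (\<epsilon> n)}" for n
    have "dist a b < \<rho> (Suc n)" if "m \<le> n" "a \<in> E n" "b \<in> E n" for n a b
    proof -
      have "c * dist a b \<le> dist (g a) (g b)"
        using that by (intro expand) (auto simp: E_def)
      also have "\<dots> < 2 * \<epsilon> n"
        using that dist_triangle[of "g a" "g b" "q n"] by (simp add: E_def dist_commute)
      also have "\<dots> = \<rho> (Suc n) / real (Suc n)"
        by (simp add: \<epsilon>_def field_simps)
      also have "\<dots> \<le> c * \<rho> (Suc n)"
      proof -
        have "1 \<le> c * real (Suc n)"
          using m(2) \<open>m \<le> n\<close> \<open>0 < c\<close> mult_left_mono[of "1 / c" "real (Suc n)" c] by simp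
        then show ?thesis
          using mult_right_mono[of 1 "c * real (Suc n)" "\<rho> (Suc n)"] pos[of "Suc n"]
          by (simp add: pos_divide_le_eq algebra_simps)
      qed
      finally show ?thesis
        using \<open>0 < c\<close> by simp
    qed
    then obtain z where z: "z \<in> K" "z \<in> cball x0 (\<rho> m)" "\<And>n. m \<le> n \<Longrightarrow> z \<notin> E n"
      using avoid[OF \<open>x0 \<in> K\<close>, of m E] by blast
    \<comment> \<open>So \<open>g z\<close> lies in the ball around \<open>q n\<close> for some
      \<open>n \<ge> m\<close>, which would put \<open>z\<close> in \<open>E n\<close>.\<close>
    have "g z \<in> W m"
      using sub z(1) by blast
    then show False
      using z m(1) by (auto simp: W_def E_def)
  qed
  ultimately show ?thesis
    by (intro exI[of _ "\<Inter>(range W)"]) auto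
qed

end
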